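(* Let $P\subset\mathbb{R}^n$ be a full-dimensional polytope with exactly $n+2$ vertices. Then the psd rank of $P$ is $n+1$.
   Context: $\mathcal{S}_+^k$ denotes the cone of $k\times k$ real symmetric positive semidefinite (psd) matrices. An $\mathcal{S}_+^k$-lift of a polytope $P\subset\mathbb{R}^n$ is a set $\mathcal{S}_+^k\cap L$, with $L$ an affine subspace of the space of real symmetric $k\times k$ matrices, such that $P=\pi(\mathcal{S}_+^k\cap L)$ for some linear map $\pi$ to $\mathbb{R}^n$. The psd rank of $P$ is the smallest positive integer $k$ such that $P$ has an $\mathcal{S}_+^k$-lift. *)

theory Defs
  imports "HOL-Analysis.Analysis" "Jordan_Normal_Form.Matrix"
begin

text \<open>
  Since the psd rank minimises over the size \<open>k\<close>, the size must be a natural number rather than a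
  type. Matrices are therefore those of \<open>Jordan_Normal_Form.Matrix\<close>, and subspaces and linear
  maps are relative to carrier sets.
\<close>

definition sym_mats :: "nat \<Rightarrow> real mat set" where
  "sym_mats k = {A \<in> carrier_mat k k. transpose_mat A = A}"

definition psd_cone :: "nat \<Rightarrow> real mat set" where
  "psd_cone k = {A \<in> sym_mats k. \<forall>v \<in> carrier_vec k. scalar_prod v (A *\<^sub>v v) \<ge> 0}"

text \<open>As with the constant \<open>affine\<close> of \<open>HOL-Analysis\<close>, the empty set counts as an affine subspace;
  it yields lifts of the empty set only.\<close>

definition affine_sym_subspace :: "nat \<Rightarrow> real mat set \<Rightarrow> bool" where
  "affine_sym_subspace k L \<longleftrightarrow> L \<subseteq> sym_mats k \<and>
     (\<forall>A\<in>L. \<forall>B\<in>L. \<forall>s t. s + t = 1 \<longrightarrow> s \<cdot>\<^sub>m A + t \<cdot>\<^sub>m B \<in> L)"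

definition linear_on_sym :: "nat \<Rightarrow> (real mat \<Rightarrow> 'a::real_vector) \<Rightarrow> bool" where
  "linear_on_sym k f \<longleftrightarrow>
     (\<forall>A\<in>sym_mats k. \<forall>B\<in>sym_mats k. f (A + B) = f A + f B) \<and>
     (\<forall>c. \<forall>A\<in>sym_mats k. f (c \<cdot>\<^sub>m A) = c *\<^sub>R f A)"

definition has_psd_lift :: "nat \<Rightarrow> 'a::real_vector set \<Rightarrow> bool" where
  "has_psd_lift k P \<longleftrightarrow>
     (\<exists>L f. affine_sym_subspace k L \<and> linear_on_sym k f \<and> P = f ` (psd_cone k \<inter> L))"

text \<open>If no lift existed, this \<open>LEAST\<close> would be an unspecified number, about which nothing can be
  proved.\<close>

definition psd_rank :: "'a::real_vector set \<Rightarrow> nat" where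
  "psd_rank P = (LEAST k. k > 0 \<and> has_psd_lift k P)"

end

theory Submission
  imports Defs
begin

text \<open>
  Lower bound: along a chain of faces of \<open>P\<close> with dimensions \<open>0, \<dots>, n\<close> choose psd matrices in the lift.
  If \<open>A\<close> lies over a facet \<open>G\<close> of \<open>F\<close> and \<open>B\<close> over a point of \<open>F - G\<close>, then \<open>ker A\<close> is not contained in
  \<open>ker B\<close>: otherwise \<open>(1 + e) A - e B\<close> would be psd for small \<open>e > 0\<close>, and the face property of \<open>G\<close>
  would fail. So the midpoint of \<open>A\<close> and \<open>B\<close> has larger rank than \<open>A\<close>. Over a vertex the rank is
  positive, as otherwise \<open>P\<close> would be unbounded. Hence rank at least \<open>n + 1\<close> occurs over \<open>P\<close>.

  Upper bound: the \<open>n + 2\<close> vertices have an affine dependence, so one vertex \<open>v\<close> is \<open>\<Sum>i. d i *\<^sub>R p i\<close> with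
  \<open>\<Sum>i. d i = 1\<close>, where the \<open>p i\<close> are the other \<open>n + 1\<close> vertices. Lift \<open>p i\<close> to the rank one matrix of the
  \<open>i\<close>-th unit vector and \<open>v\<close> to that of the vector with entries \<open>sgn (d i) * sqrt \<bar>d i\<bar>\<close>. For affine
  coordinates \<open>w\<close> and \<open>d i > 0 > d j\<close> the slack \<open>w i / \<bar>d i\<bar> + w j / \<bar>d j\<bar>\<close> of each vertex is then the
  square of a fixed linear form in the vector of that vertex.
\<close>

section \<open>Symmetric matrices as bilinear forms, and the psd cone\<close>

text \<open>Vectors are plain functions of which only the entries below \<open>k\<close> count, so
  both the vectors of \<open>carrier_vec k\<close> and the coordinates of a point of a Euclidean
  space can be inserted.\<close>

definition mat_form :: "nat \<Rightarrow> real mat \<Rightarrow> (nat \<Rightarrow> real) \<Rightarrow> (nat \<Rightarrow> real) \<Rightarrow> real" where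
  "mat_form k A x y = (\<Sum>i<k. \<Sum>j<k. A $$ (i, j) * x i * y j)"

lemma sym_matsD:
  assumes "A \<in> sym_mats k"
  shows "A \<in> carrier_mat k k" "i < k \<Longrightarrow> j < k \<Longrightarrow> A $$ (i, j) = A $$ (j, i)"
proof -
  show A: "A \<in> carrier_mat k k"
    using assms by (simp add: sym_mats_def)
  have T: "transpose_mat A = A"
    using assms by (simp add: sym_mats_def)
  assume "i < k" "j < k"
  then have "transpose_mat A $$ (i, j) = A $$ (j, i)"
    using A by auto
  then show "A $$ (i, j) = A $$ (j, i)"
    by (simp add: T)
qed

lemma sym_matsI:
  assumes "A \<in> carrier_mat k k" "\<And>i j. i < k \<Longrightarrow> j < k \<Longrightarrow> A $$ (i, j) = A $$ (j, i)"
  shows "A \<in> sym_mats k"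
  unfolding sym_mats_def using assms by (auto intro!: eq_matI)

lemma sym_mats_comb:
  assumes "A \<in> sym_mats k" "B \<in> sym_mats k"
  shows "s \<cdot>\<^sub>m A + t \<cdot>\<^sub>m B \<in> sym_mats k"
  by (rule sym_matsI) (use sym_matsD[OF assms(1)] sym_matsD[OF assms(2)] in auto)

lemma mat_form_comb:
  assumes "A \<in> sym_mats k" "B \<in> sym_mats k"
  shows "mat_form k (s \<cdot>\<^sub>m A + t \<cdot>\<^sub>m B) x y = s * mat_form k A x y + t * mat_form k B x y"
proof -
  have "mat_form k (s \<cdot>\<^sub>m A + t \<cdot>\<^sub>m B) x y =
      (\<Sum>i<k. \<Sum>j<k. s * (A $$ (i, j) * x i * y j) + t * (B $$ (i, j) * x i * y j))"
    unfolding mat_form_def using sym_matsD(1)[OF assms(1)] sym_matsD(1)[OF assms(2)]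
    by (intro sum.cong) (auto simp: algebra_simps)
  then show ?thesis
    by (simp add: mat_form_def sum.distrib sum_distrib_left)
qed

lemma mat_form_commute:
  assumes "A \<in> sym_mats k"
  shows "mat_form k A x y = mat_form k A y x"
  unfolding mat_form_def
  by (subst sum.swap) (auto intro!: sum.cong simp: sym_matsD(2)[OF assms])

lemma scalar_prod_eq_mat_form:
  assumes "A \<in> carrier_mat k k" "v \<in> carrier_vec k"
  shows "scalar_prod v (A *\<^sub>v v) = mat_form k A (vec_index v) (vec_index v)"
proof -
  have "scalar_prod v (A *\<^sub>v v) = (\<Sum>i<k. vec_index v i * (\<Sum>j<k. A $$ (i, j) * vec_index v j))"
    using assms by (auto simp: scalar_prod_def lessThan_atLeast0 intro!: sum.cong)
  then show ?thesis
    by (simp add: mat_form_def sum_distrib_left mult_ac)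
qed

lemma psd_cone_iff:
  "A \<in> psd_cone k \<longleftrightarrow> A \<in> sym_mats k \<and> (\<forall>x. 0 \<le> mat_form k A x x)"
proof (cases "A \<in> sym_mats k")
  case True
  have *: "0 \<le> mat_form k A x x" if "\<forall>v\<in>carrier_vec k. scalar_prod v (A *\<^sub>v v) \<ge> 0" for x
  proof -
    have "scalar_prod (Matrix.vec k x) (A *\<^sub>v Matrix.vec k x) \<ge> 0"
      using that by auto
    moreover have "mat_form k A (vec_index (Matrix.vec k x)) (vec_index (Matrix.vec k x)) =
        mat_form k A x x"
      by (simp add: mat_form_def)
    ultimately show ?thesis
      by (simp add: scalar_prod_eq_mat_form[OF sym_matsD(1)[OF True]])
  qed
  show ?thesis
    using * True by (auto simp: psd_cone_def scalar_prod_eq_mat_form[OF sym_matsD(1)[OF True]])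
qed (auto simp: psd_cone_def)

lemma psd_cone_comb:
  assumes "A \<in> psd_cone k" "B \<in> psd_cone k" "0 \<le> s" "0 \<le> t"
  shows "s \<cdot>\<^sub>m A + t \<cdot>\<^sub>m B \<in> psd_cone k"
  using assms by (auto simp: psd_cone_iff sym_mats_comb mat_form_comb)

lemma linear_on_sym_comb:
  assumes "linear_on_sym k f" "A \<in> sym_mats k" "B \<in> sym_mats k"
  shows "f (s \<cdot>\<^sub>m A + t \<cdot>\<^sub>m B) = s *\<^sub>R f A + t *\<^sub>R f B"
proof -
  have "s \<cdot>\<^sub>m A \<in> sym_mats k" "t \<cdot>\<^sub>m B \<in> sym_mats k"
    by (rule sym_matsI; use sym_matsD[OF assms(2)] sym_matsD[OF assms(3)] in auto)+
  then show ?thesis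
    using assms by (auto simp: linear_on_sym_def)
qed

section \<open>Null spaces of psd bilinear forms\<close>

text \<open>If \<open>b x y\<close> were nonzero, the form at \<open>x + t *\<^sub>R y\<close> would
  be affine in \<open>t\<close> with nonzero slope, hence negative somewhere; \<open>t\<close> is
  solved for the value \<open>-1\<close>.\<close>

lemma psd_form_zero:
  fixes b :: "'a::real_vector \<Rightarrow> 'a \<Rightarrow> real"
  assumes "bilinear b" "\<And>x y. b x y = b y x" "\<And>x. 0 \<le> b x x" "b y y = 0"
  shows "b x y = 0"
proof (rule ccontr)
  assume "b x y \<noteq> 0"
  define t where "t = - (b x x + 1) / (2 * b x y)"
  have "b (x + t *\<^sub>R y) (x + t *\<^sub>R y) = b x x + 2 * t * b x y"
    using assms(1,4) assms(2)[of y x]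
    by (simp add: bilinear_ladd bilinear_radd bilinear_lmul bilinear_rmul)
  also have "\<dots> = -1"
    using \<open>b x y \<noteq> 0\<close> by (simp add: t_def field_simps)
  finally show False
    using assms(3)[of "x + t *\<^sub>R y"] by simp
qed

lemma psd_form_add_null:
  fixes b :: "'a::real_vector \<Rightarrow> 'a \<Rightarrow> real"
  assumes "bilinear b" "\<And>x y. b x y = b y x" "\<And>x. 0 \<le> b x x" "b y y = 0"
  shows "b (y + x) (y + x) = b x x"
  using psd_form_zero[OF assms, of x] assms(1,4) assms(2)[of y x]
  by (simp add: bilinear_ladd bilinear_radd)

text \<open>Mixed terms with a null vector vanish, so the null vectors of a psd form make up its
  kernel.\<close>

lemma subspace_psd_form_null:
  fixes b :: "'a::real_vector \<Rightarrow> 'a \<Rightarrow> real"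
  assumes "bilinear b" "\<And>x y. b x y = b y x" "\<And>x. 0 \<le> b x x"
  shows "subspace {x. b x x = 0}"
  using psd_form_add_null[OF assms] assms(1)
  by (auto simp: subspace_def bilinear_lzero bilinear_lmul bilinear_rmul)

text \<open>On the unit sphere of the orthogonal complement of the null space of \<open>b\<close>,
  compactness bounds \<open>b\<close> below by some \<open>m > 0\<close>, while \<open>c\<close> is
  bounded above by \<open>M\<close>; so \<open>e = m / M\<close> works there. A component in the
  null space changes neither form.\<close>

lemma psd_form_dominates:
  fixes b c :: "'a::euclidean_space \<Rightarrow> 'a \<Rightarrow> real"
  assumes b: "bilinear b" "\<And>x y. b x y = b y x" "\<And>x. 0 \<le> b x x"
    and c: "bilinear c" "\<And>x y. c x y = c y x" "\<And>x. 0 \<le> c x x"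
    and null: "\<And>x. b x x = 0 \<Longrightarrow> c x x = 0"
  obtains e where "e > 0" "\<And>x. e * c x x \<le> b x x"
proof -
  define N where "N = {x. b x x = 0}"
  have subN: "subspace N"
    unfolding N_def by (rule subspace_psd_form_null[OF b])
  define S where "S = sphere 0 1 \<inter> orthogonal_comp N"
  have compS: "compact S"
    unfolding S_def
    by (intro compact_Int_closed closed_subspace subspace_orthogonal_comp) auto
  have bb: "bounded_bilinear b" and bc: "bounded_bilinear c"
    using b(1) c(1) by (simp_all add: bilinear_conv_bounded_bilinear)
  have contb: "continuous_on S (\<lambda>x. b x x)"
    by (intro bounded_bilinear.continuous_on[OF bb] continuous_on_id)
  have Spos: "0 < b z z" if "z \<in> S" for z
  proof (rule ccontr)
    assume "\<not> 0 < b z z"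
    then have "z \<in> N"
      using b(3)[of z] by (simp add: N_def)
    then have "inner z z = 0"
      using that by (auto simp: S_def orthogonal_comp_def real_inner_class.orthogonal_def)
    then show False
      using that by (simp add: S_def)
  qed
  obtain m where m: "m > 0" "\<And>z. z \<in> S \<Longrightarrow> m \<le> b z z"
  proof (cases "S = {}")
    case False
    then obtain w where "w \<in> S" "\<forall>z\<in>S. b w w \<le> b z z"
      using continuous_attains_inf[OF compS _ contb] by auto
    then show ?thesis
      using that[of "b w w"] Spos by auto
  \<comment> \<open>\<open>S\<close> is empty when \<open>b\<close> vanishes identically; any
    positive \<open>m\<close> will then do.\<close>
  qed (use that[of 1] in auto)
  obtain M where M: "M > 0" "\<And>x y. norm (c x y) \<le> norm x * norm y * M"
    using bounded_bilinear.pos_bounded[OF bc] by blast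
  have comp: "m / M * c z z \<le> b z z" if z: "z \<in> orthogonal_comp N" for z
  proof (cases "z = 0")
    case True
    then show ?thesis
      using b(1) c(1) by (simp add: bilinear_lzero)
  next
    case False
    have "(1 / norm z) *\<^sub>R z \<in> S"
      using z False by (auto simp: S_def intro: subspace_scale[OF subspace_orthogonal_comp])
    then have "m \<le> b ((1 / norm z) *\<^sub>R z) ((1 / norm z) *\<^sub>R z)"
      by (rule m(2))
    also have "\<dots> = b z z / (norm z)\<^sup>2"
      using b(1) by (simp add: bilinear_lmul bilinear_rmul power2_eq_square)
    finally have 1: "m * (norm z)\<^sup>2 \<le> b z z"
      using False by (simp add: field_simps)
    have "c z z \<le> (norm z)\<^sup>2 * M"
      using M(2)[of z z] by (simp add: power2_eq_square)
    then have "m / M * c z z \<le> m / M * ((norm z)\<^sup>2 * M)"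
      using m(1) M(1) by (intro mult_left_mono) auto
    also have "\<dots> = m * (norm z)\<^sup>2"
      using M(1) by simp
    finally show ?thesis
      using 1 by simp
  qed
  show ?thesis
  proof (rule that[of "m / M"])
    fix x
    obtain y z where yz: "y \<in> span N" "\<And>w. w \<in> span N \<Longrightarrow> real_inner_class.orthogonal z w" "x = y + z"
      using orthogonal_subspace_decomp_exists[of N x] by metis
    have "y \<in> N"
      using yz(1) subN by (simp add: span_eq_iff[THEN iffD2])
    then have "b y y = 0" "c y y = 0"
      using null by (auto simp: N_def)
    then have "b x x = b z z" "c x x = c z z"
      using psd_form_add_null[OF b] psd_form_add_null[OF c] yz(3) by auto
    moreover have "z \<in> orthogonal_comp N"
      using yz(2) by (auto simp: orthogonal_comp_def span_base orthogonal_commute)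
    ultimately show "m / M * c x x \<le> b x x"
      using comp by simp
  qed (use m M in simp)
qed

section \<open>Lower bound: ranks along a chain of faces\<close>

lemma bilinear_mat_form:
  "bilinear (\<lambda>x y. mat_form k A (\<lambda>i. inner x (g i)) (\<lambda>i. inner y (g i)))"
  unfolding bilinear_def mat_form_def
  by (auto intro!: linearI simp: inner_add_left inner_scaleR_left algebra_simps sum.distrib
      sum_distrib_left)

text \<open>Coordinates along distinct basis vectors can be prescribed freely, so inequalities
  between pulled-back forms carry over to the matrices.\<close>

lemma mat_form_surj:
  fixes g :: "nat \<Rightarrow> 'a::euclidean_space"
  assumes "inj_on g {..<k}" "g ` {..<k} \<subseteq> Basis"
  obtains x where "mat_form k A v v = mat_form k A (\<lambda>i. inner x (g i)) (\<lambda>i. inner x (g i))"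
proof -
  define x where "x = (\<Sum>j<k. v j *\<^sub>R g j)"
  have "inner x (g i) = v i" if "i < k" for i
  proof -
    have "g j = g i \<longleftrightarrow> j = i" if "j < k" for j
      using assms(1) that \<open>i < k\<close> by (auto simp: inj_on_eq_iff)
    moreover have "g j \<in> Basis" if "j < k" for j
      using assms(2) that by auto
    ultimately have "inner x (g i) = (\<Sum>j<k. if j = i then v j else 0)"
      unfolding x_def inner_sum_left using that
      by (intro sum.cong) (auto simp: inner_Basis)
    then show ?thesis
      using that by simp
  qed
  then show ?thesis
    by (intro that[of x]) (simp add: mat_form_def)
qed

text \<open>The forms of \<open>k \<times> k\<close> matrices are pulled back to \<open>'a\<close> along part of its basis, so that
  kernels are subspaces of a Euclidean space, where \<open>dim\<close> is available.\<close>

lemma lift_face_null_dim: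
  fixes P :: "'a::euclidean_space set" and g :: "nat \<Rightarrow> 'a" and f :: "real mat \<Rightarrow> 'a" and k :: nat
  defines "q \<equiv> \<lambda>A x y. mat_form k A (\<lambda>i. inner x (g i)) (\<lambda>i. inner y (g i))"
  assumes L: "affine_sym_subspace k L" and f: "linear_on_sym k f"
    and P: "P = f ` (psd_cone k \<inter> L)"
    and poly: "polytope P" and dimP: "aff_dim P \<ge> 1"
    and g: "inj_on g {..<k}" "g ` {..<k} \<subseteq> Basis"
    and F: "F face_of P" "aff_dim F = int d"
  shows "\<exists>A\<in>psd_cone k \<inter> L. f A \<in> F \<and> dim {x. q A x x = 0} + d + 1 \<le> DIM('a)"
  using F
proof (induction d arbitrary: F)
  \<comment> \<open>The null space of the pulled-back form has dimension \<open>DIM('a)\<close>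
    minus the rank of \<open>A\<close>, so the claim is that \<open>A\<close> has rank at least
    \<open>d + 1\<close>.\<close>
  case 0
  then obtain v where v: "F = {v}"
    by (auto simp: aff_dim_eq_0)
  then have "v \<in> P"
    using 0 face_of_imp_subset by blast
  then obtain A where A: "A \<in> psd_cone k" "A \<in> L" "f A = v"
    using P by auto
  have symA: "A \<in> sym_mats k" using A by (simp add: psd_cone_iff)
  have "{x. q A x x = 0} \<noteq> UNIV"
  proof
    assume "{x. q A x x = 0} = UNIV"
    then have qA: "q A x x = 0" for x by auto
    have mA: "mat_form k A w w = 0" for w
      using mat_form_surj[OF g, of A w] qA by (metis q_def)
    obtain y where y: "y \<in> P" "y \<noteq> v"
    proof -
      have "\<not> P \<subseteq> {v}"
        using dimP aff_dim_subset[of P "{v}"] by auto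
      then show ?thesis using that by auto
    qed
    obtain B where B: "B \<in> psd_cone k" "B \<in> L" "f B = y"
      using y P by auto
    have symB: "B \<in> sym_mats k" using B by (simp add: psd_cone_iff)
    \<comment> \<open>As the form of \<open>A\<close> vanishes, the coefficient \<open>1 - t\<close>
      may be negative without leaving the cone; so \<open>P\<close> contains the ray from
      \<open>v\<close> through \<open>y\<close>.\<close>
    have inP: "t *\<^sub>R y + (1 - t) *\<^sub>R v \<in> P" if "t \<ge> 0" for t
    proof -
      have "t \<cdot>\<^sub>m B + (1 - t) \<cdot>\<^sub>m A \<in> psd_cone k"
        using that B symA symB by (simp add: psd_cone_iff sym_mats_comb mat_form_comb mA)
      moreover have "t \<cdot>\<^sub>m B + (1 - t) \<cdot>\<^sub>m A \<in> L"
        using L A B by (simp add: affine_sym_subspace_def)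
      ultimately have "f (t \<cdot>\<^sub>m B + (1 - t) \<cdot>\<^sub>m A) \<in> P"
        using P by blast
      then show ?thesis
        using linear_on_sym_comb[OF f symB symA] A B by simp
    qed
    obtain M where M: "\<And>x. x \<in> P \<Longrightarrow> norm x \<le> M"
      using polytope_imp_bounded[OF poly] by (auto simp: bounded_iff)
    \<comment> \<open>Chosen so that the point of the ray at parameter \<open>t\<close> has norm at
      least \<open>M + 1\<close>.\<close>
    define t where "t = (M + norm v + 1) / norm (y - v)"
    have pos: "norm (y - v) > 0" using y by simp
    have M0: "M \<ge> 0" using M[OF y(1)] norm_ge_zero order_trans by blast
    have t0: "t \<ge> 0" using M0 by (simp add: t_def)
    have "norm (t *\<^sub>R (y - v)) = M + norm v + 1"
      using pos t0 M0 by (simp add: t_def)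
    moreover have "t *\<^sub>R (y - v) = (t *\<^sub>R y + (1 - t) *\<^sub>R v) - v"
      by (simp add: algebra_simps)
    ultimately have "M + norm v + 1 \<le> norm (t *\<^sub>R y + (1 - t) *\<^sub>R v) + norm v"
      by (metis norm_triangle_ineq4)
    then show False
      using M[OF inP[OF t0]] by simp
  qed
  moreover have "subspace {x. q A x x = 0}"
    unfolding q_def using A mat_form_commute[OF symA]
    by (intro subspace_psd_form_null bilinear_mat_form) (auto simp: psd_cone_iff)
  ultimately have "dim {x. q A x x = 0} < DIM('a)"
    by (metis dim_eq_full dim_subset_UNIV le_neq_implies_less span_eq_iff)
  then show ?case
    using A v by auto
next
  case (Suc d)
  have "polytope F"
    using Suc.prems poly face_of_polytope_polytope by blast
  moreover have "F \<noteq> {}"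
    using Suc.prems by auto
  ultimately obtain G where G: "G facet_of F"
    using polytope_facet_exists[of F] Suc.prems by auto
  \<comment> \<open>Being a face of \<open>P\<close> itself, \<open>G\<close> falls under the
    induction hypothesis for the same lift.\<close>
  have GP: "G face_of P"
    using G Suc.prems(1) face_of_trans facet_of_imp_face_of by blast
  have "aff_dim G = int d"
    using G Suc.prems(2) by (simp add: facet_of_def)
  then obtain A where A: "A \<in> psd_cone k" "A \<in> L" "f A \<in> G"
    and dA: "dim {x. q A x x = 0} + d + 1 \<le> DIM('a)"
    using Suc.IH[OF GP] by auto
  have GF: "G \<subseteq> F" using G facet_of_imp_subset by blast
  have "G \<noteq> F" using G by auto
  then obtain y where y: "y \<in> F" "y \<notin> G" using GF by auto
  then have "y \<in> P" using Suc.prems(1) face_of_imp_subset by blast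
  then obtain B where B: "B \<in> psd_cone k" "B \<in> L" "f B = y"
    using P by auto
  have sym: "A \<in> sym_mats k" "B \<in> sym_mats k"
    using A B by (simp_all add: psd_cone_iff)
  have qpsd: "bilinear (q C)" "\<And>x y. q C x y = q C y x" "\<And>x. 0 \<le> q C x x"
    if "C \<in> psd_cone k" for C
    using that mat_form_commute[of C k] unfolding q_def
    by (auto simp: psd_cone_iff bilinear_mat_form)
  have not_sub: "\<not> {x. q A x x = 0} \<subseteq> {x. q B x x = 0}"
  proof
    assume "{x. q A x x = 0} \<subseteq> {x. q B x x = 0}"
    then obtain e where e: "e > 0" "\<And>x. e * q B x x \<le> q A x x"
      using psd_form_dominates[OF qpsd[OF A(1)] qpsd[OF B(1)]] by blast
    define C where "C = (1 + e) \<cdot>\<^sub>m A + (- e) \<cdot>\<^sub>m B"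
    have "0 \<le> mat_form k C w w" for w
    proof -
      obtain x where "mat_form k C w w = q C x x"
        using mat_form_surj[OF g, of C w] by (metis q_def)
      moreover have "q C x x = (1 + e) * q A x x - e * q B x x"
        unfolding q_def C_def by (simp add: mat_form_comb[OF sym])
      moreover have "0 \<le> e * q A x x" using e qpsd(3)[OF A(1)] by simp
      ultimately show ?thesis
        using e(2)[of x] by (simp add: algebra_simps)
    qed
    then have C: "C \<in> psd_cone k"
      unfolding psd_cone_iff using sym_mats_comb[OF sym] by (simp add: C_def)
    have "C \<in> L"
      using L A B unfolding C_def affine_sym_subspace_def by simp
    then have CP: "f C \<in> P" using C P by auto
    have fC: "f C = (1 + e) *\<^sub>R f A + (- e) *\<^sub>R y"
      unfolding C_def using linear_on_sym_comb[OF f sym] B by simp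
    \<comment> \<open>The weight of \<open>y\<close> when \<open>f A\<close> is written as a convex
      combination of \<open>f C\<close> and \<open>y\<close>.\<close>
    define u where "u = e / (1 + e)"
    have u: "0 < u" "u < 1" using e by (auto simp: u_def field_simps)
    have "(1 - u) *\<^sub>R f C + u *\<^sub>R y = ((1 - u) * (1 + e)) *\<^sub>R f A + (u - (1 - u) * e) *\<^sub>R y"
      by (simp add: fC algebra_simps)
    also have "\<dots> = f A"
    proof -
      have "(1 - u) * (1 + e) = 1" "u - (1 - u) * e = 0"
        using e by (auto simp: u_def field_simps)
      then show ?thesis by simp
    qed
    finally have fA: "f A = (1 - u) *\<^sub>R f C + u *\<^sub>R y" by simp
    have "f C \<noteq> y"
    proof
      assume "f C = y"
      then have "f A = y" using fA by (simp add: algebra_simps)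
      then show False using A y by simp
    qed
    then have "f A \<in> open_segment (f C) y"
      using fA u by (auto simp: in_segment)
    then have "y \<in> G"
      using face_ofD[OF GP _ CP \<open>y \<in> P\<close> A(3)] by simp
    then show False using y by simp
  qed
  define C where "C = (1/2) \<cdot>\<^sub>m A + (1/2) \<cdot>\<^sub>m B"
  have C: "C \<in> psd_cone k" unfolding C_def using A B by (intro psd_cone_comb) auto
  have CL: "C \<in> L" using L A B unfolding C_def affine_sym_subspace_def by simp
  have qC: "q C x x = q A x x / 2 + q B x x / 2" for x
    unfolding q_def C_def by (simp add: mat_form_comb[OF sym])
  have fC: "f C = (1/2) *\<^sub>R f A + (1/2) *\<^sub>R y"
    unfolding C_def using linear_on_sym_comb[OF f sym] B by simp
  have "convex F" using Suc.prems(1) face_of_imp_convex by blast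
  then have "f C \<in> F"
    unfolding fC using A(3) GF y(1) by (intro convexD) auto
  \<comment> \<open>Both summands are nonnegative, so the kernel of the midpoint is the intersection
    of the two kernels, which \<open>not_sub\<close> makes strictly smaller than that of
    \<open>A\<close>.\<close>
  have "q C x x = 0 \<longleftrightarrow> q A x x = 0 \<and> q B x x = 0" for x
    using qC[of x] qpsd(3)[OF A(1), of x] qpsd(3)[OF B(1), of x] by auto
  then have "{x. q C x x = 0} \<subset> {x. q A x x = 0}"
    using not_sub by auto
  moreover have "subspace {x. q C x x = 0}" "subspace {x. q A x x = 0}"
    using subspace_psd_form_null[OF qpsd[OF C]] subspace_psd_form_null[OF qpsd[OF A(1)]] .
  ultimately have "dim {x. q C x x = 0} < dim {x. q A x x = 0}"
    by (intro dim_psubset) (simp add: span_eq_iff[THEN iffD2])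
  then show ?case
    using C CL \<open>f C \<in> F\<close> dA by (intro bexI[of _ C]) auto
qed

text \<open>A pulled-back form vanishes on the basis vectors outside the image of \<open>g\<close>,
  so its null space has dimension at least \<open>DIM('a) - k\<close>. The face bound for
  \<open>P\<close> as a face of itself then forces \<open>d + 1 \<le> k\<close>.\<close>

lemma psd_lift_size_ge:
  fixes P :: "'a::euclidean_space set"
  assumes "has_psd_lift k P" "polytope P" "aff_dim P = int d" "d \<ge> 1"
  shows "d + 1 \<le> k"
proof (cases "k \<le> DIM('a)")
  \<comment> \<open>For \<open>k > DIM('a)\<close> the basis is too small for an injective
    \<open>g\<close>, but the claim follows from \<open>d \<le> DIM('a)\<close>.\<close>
  case False
  then show ?thesis using assms(3) aff_dim_le_DIM[of P] by simp
next
  case True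
  obtain L f where L: "affine_sym_subspace k L" "linear_on_sym k f" "P = f ` (psd_cone k \<inter> L)"
    using assms(1) by (auto simp: has_psd_lift_def)
  have "card {..<k} \<le> card (Basis :: 'a set)" using True by simp
  then obtain g :: "nat \<Rightarrow> 'a" where g: "g ` {..<k} \<subseteq> Basis" "inj_on g {..<k}"
    using card_le_inj[of "{..<k}" "Basis :: 'a set"] by auto
  obtain A where A: "dim {x :: 'a. mat_form k A (\<lambda>i. inner x (g i)) (\<lambda>i. inner x (g i)) = 0}
      + d + 1 \<le> DIM('a)"
    using lift_face_null_dim[OF L assms(2) _ g(2,1) face_of_refl[of P] assms(3)] assms(2-4)
    by (auto simp: polytope_imp_convex)
  have "Basis - g ` {..<k} \<subseteq>
      {x. mat_form k A (\<lambda>i. inner x (g i)) (\<lambda>i. inner x (g i)) = 0}"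
  proof
    fix x assume x: "x \<in> Basis - g ` {..<k}"
    then have "inner x (g i) = 0" if "i < k" for i
      using g(1) that by (auto simp: inner_Basis image_subset_iff)
    then show "x \<in> {x. mat_form k A (\<lambda>i. inner x (g i)) (\<lambda>i. inner x (g i)) = 0}"
      by (simp add: mat_form_def)
  qed
  then have "dim (Basis - g ` {..<k})
      \<le> dim {x. mat_form k A (\<lambda>i. inner x (g i)) (\<lambda>i. inner x (g i)) = 0}"
    by (rule dim_subset)
  moreover have "dim (Basis - g ` {..<k}) = DIM('a) - k"
  proof -
    have "independent (Basis - g ` {..<k})"
      using independent_mono[OF independent_Basis] by blast
    then have "dim (Basis - g ` {..<k}) = card (Basis - g ` {..<k})"
      by (rule dim_eq_card_independent)
    then show ?thesis
      using g by (simp add: card_Diff_subset card_image)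
  qed
  ultimately show ?thesis
    using A True by simp
qed

section \<open>Upper bound: a lift of size \<open>k\<close> for \<open>k + 1\<close> affinely
  dependent points\<close>

text \<open>Writing \<open>x\<close> as a sum of two indicators covers \<open>i = j\<close> as well;
  with \<open>s = 1\<close> and \<open>t = 0\<close> that case yields the diagonal entries.\<close>

lemma mat_form_two_points:
  fixes s t :: real
  assumes "A \<in> sym_mats k" "i < k" "j < k"
  defines "x \<equiv> \<lambda>l. (if l = i then s else 0) + (if l = j then t else 0)"
  shows "mat_form k A x x = s\<^sup>2 * A $$ (i, i) + 2 * s * t * A $$ (i, j) + t\<^sup>2 * A $$ (j, j)"
proof -
  have *: "(\<Sum>l<k. x l * h l) = s * h i + t * h j" for h :: "nat \<Rightarrow> real"
  proof -
    have "(\<Sum>l<k. x l * h l) = (\<Sum>l<k. (if l = i then s * h i else 0) + (if l = j then t * h j else 0))"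
      by (intro sum.cong) (auto simp: x_def algebra_simps)
    then show ?thesis
      using assms(2,3) by (simp add: sum.distrib)
  qed
  have "mat_form k A x x = (\<Sum>l<k. x l * (\<Sum>m<k. x m * A $$ (l, m)))"
    unfolding mat_form_def sum_distrib_left by (intro sum.cong) simp_all
  also have "\<dots> = s * (s * A $$ (i, i) + t * A $$ (i, j)) + t * (s * A $$ (j, i) + t * A $$ (j, j))"
    by (simp only: *)
  finally show ?thesis
    using sym_matsD(2)[OF assms(1-3)] by (simp add: power2_eq_square algebra_simps)
qed

definition outer_square :: "nat \<Rightarrow> (nat \<Rightarrow> real) \<Rightarrow> real mat" where
  "outer_square k c = mat k k (\<lambda>(i, j). c i * c j)"

lemma outer_square_psd: "outer_square k c \<in> psd_cone k"
proof -
  have "mat_form k (outer_square k c) x x = (\<Sum>i<k. c i * x i)\<^sup>2" for x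
    by (simp add: mat_form_def outer_square_def power2_eq_square sum_product mult_ac)
  moreover have "outer_square k c \<in> sym_mats k"
    by (rule sym_matsI) (auto simp: outer_square_def)
  ultimately show ?thesis
    by (simp add: psd_cone_iff)
qed

lemma psd_lift_points_with_dependency:
  fixes p :: "nat \<Rightarrow> 'a::real_vector" and d :: "nat \<Rightarrow> real"
  assumes i0: "i0 < k" "d i0 > 0" and d1: "(\<Sum>i<k. d i) = 1"
    and v: "v = (\<Sum>i<k. d i *\<^sub>R p i)"
  shows "has_psd_lift k (convex hull (insert v (p ` {..<k})))"
proof -
  \<comment> \<open>\<open>lam X\<close> lists the affine coordinates of \<open>f X\<close> with respect to the \<open>p i\<close>. For \<open>d i > 0 > d j\<close> the
    condition on \<open>X $$ (i, j)\<close> in \<open>L\<close> makes the slack \<open>lam X i / d i - lam X j / d j\<close> the value of the form \<open>X\<close>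
    at the vector with entries \<open>1 / sqrt (d i)\<close> and \<open>1 / sqrt (- d j)\<close>. Together
    with the \<open>lam X i\<close> for \<open>d i \<ge> 0\<close> these slacks cut out the convex hull.\<close>
  define lam where "lam X i = (if d i < 0 then X $$ (i, i) + 2 * X $$ (i0, i) * sqrt (- d i / d i0)
      else X $$ (i, i))" for X :: "real mat" and i
  define f where "f X = (\<Sum>i<k. lam X i *\<^sub>R p i)" for X
  define L where "L = {X \<in> sym_mats k. (\<Sum>i<k. lam X i) = 1 \<and>
      (\<forall>i<k. \<forall>j<k. d i > 0 \<longrightarrow> d j < 0 \<longrightarrow> X $$ (i, j) * sqrt (d i0) = X $$ (i0, j) * sqrt (d i))}"
  define H where "H = convex hull (insert v (p ` {..<k}))"
  have lam_comb: "lam (s \<cdot>\<^sub>m A + t \<cdot>\<^sub>m B) i = s * lam A i + t * lam B i"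
    if "A \<in> sym_mats k" "B \<in> sym_mats k" "i < k" for A B s t i
    using sym_matsD(1)[OF that(1)] sym_matsD(1)[OF that(2)] that(3) i0(1)
    by (auto simp: lam_def algebra_simps)
  have f_comb: "f (s \<cdot>\<^sub>m A + t \<cdot>\<^sub>m B) = s *\<^sub>R f A + t *\<^sub>R f B"
    if "A \<in> sym_mats k" "B \<in> sym_mats k" for A B s t
    by (simp add: f_def lam_comb[OF that] scaleR_add_left sum.distrib scaleR_right.sum)
  have aff: "affine_sym_subspace k L"
    unfolding affine_sym_subspace_def
  proof (intro conjI ballI allI impI)
    show "L \<subseteq> sym_mats k" by (auto simp: L_def)
    fix A B s t
    assume A: "A \<in> L" and B: "B \<in> L" and st: "s + t = (1::real)"
    have sym: "A \<in> sym_mats k" "B \<in> sym_mats k" using A B by (auto simp: L_def)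
    have "(\<Sum>i<k. lam (s \<cdot>\<^sub>m A + t \<cdot>\<^sub>m B) i) = s * (\<Sum>i<k. lam A i) + t * (\<Sum>i<k. lam B i)"
      by (simp add: lam_comb[OF sym] sum.distrib sum_distrib_left)
    also have "\<dots> = 1" using A B st by (simp add: L_def)
    finally have 1: "(\<Sum>i<k. lam (s \<cdot>\<^sub>m A + t \<cdot>\<^sub>m B) i) = 1" .
    have 2: "(s \<cdot>\<^sub>m A + t \<cdot>\<^sub>m B) $$ (i, j) * sqrt (d i0) = (s \<cdot>\<^sub>m A + t \<cdot>\<^sub>m B) $$ (i0, j) * sqrt (d i)"
      if ij: "i < k" "j < k" "d i > 0" "d j < 0" for i j
    proof -
      have "A $$ (i, j) * sqrt (d i0) = A $$ (i0, j) * sqrt (d i)"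
        "B $$ (i, j) * sqrt (d i0) = B $$ (i0, j) * sqrt (d i)"
        using A B ij by (auto simp: L_def)
      then have "s * (A $$ (i, j) * sqrt (d i0)) + t * (B $$ (i, j) * sqrt (d i0)) =
          s * (A $$ (i0, j) * sqrt (d i)) + t * (B $$ (i0, j) * sqrt (d i))"
        by simp
      then show ?thesis
        using sym_matsD(1)[OF sym(1)] sym_matsD(1)[OF sym(2)] ij i0(1)
        by (simp add: algebra_simps)
    qed
    show "s \<cdot>\<^sub>m A + t \<cdot>\<^sub>m B \<in> L"
      using 1 2 sym_mats_comb[OF sym] by (simp add: L_def)
  qed
  have lin: "linear_on_sym k f"
    unfolding linear_on_sym_def
  proof (intro conjI ballI allI)
    fix A B assume AB: "A \<in> sym_mats k" "B \<in> sym_mats k"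
    have "1 \<cdot>\<^sub>m A + 1 \<cdot>\<^sub>m B = A + B"
      using sym_matsD(1)[OF AB(1)] sym_matsD(1)[OF AB(2)] by (intro eq_matI) auto
    then show "f (A + B) = f A + f B"
      using f_comb[OF AB, of 1 1] by simp
  next
    fix c A assume A: "A \<in> sym_mats k"
    have "c \<cdot>\<^sub>m A + 0 \<cdot>\<^sub>m A = c \<cdot>\<^sub>m A"
      using sym_matsD(1)[OF A] by (intro eq_matI) auto
    then show "f (c \<cdot>\<^sub>m A) = c *\<^sub>R f A"
      using f_comb[OF A A, of c 0] by simp
  qed
  have p_in: "p i \<in> f ` (psd_cone k \<inter> L)" if i: "i < k" for i
  proof -
    let ?E = "outer_square k (\<lambda>l. if l = i then 1 else 0)"
    have E: "?E $$ (l, m) = (if l = i \<and> m = i then 1 else 0)" if "l < k" "m < k" for l m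
      using that by (simp add: outer_square_def)
    \<comment> \<open>Since \<open>d i0 > 0\<close>, the index \<open>i0\<close> differs from every
      \<open>l\<close> with \<open>d l < 0\<close>, so the correction term in \<open>lam\<close> is
      an off-diagonal entry and vanishes.\<close>
    have lamE: "lam ?E l = (if l = i then 1 else 0)" if "l < k" for l
      using that i0 by (auto simp: lam_def E)
    have "f ?E = (\<Sum>l<k. if l = i then p l else 0)"
      unfolding f_def by (intro sum.cong) (auto simp: lamE)
    then have "f ?E = p i" using i by simp
    moreover have "?E \<in> L"
      using outer_square_psd[of k "\<lambda>l. if l = i then 1 else 0"] i i0
      by (auto simp: L_def psd_cone_iff lamE E)
    ultimately show ?thesis
      using outer_square_psd[of k "\<lambda>l. if l = i then 1 else 0"] by (intro rev_image_eqI[of ?E]) auto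
  qed
  have v_in: "v \<in> f ` (psd_cone k \<inter> L)"
  proof -
    \<comment> \<open>Hadamard square root of \<open>d\<close> with signs.\<close>
    define c where "c i = (if d i < 0 then - sqrt (- d i) else sqrt (d i))" for i
    let ?C = "outer_square k c"
    have C: "?C $$ (l, m) = c l * c m" if "l < k" "m < k" for l m
      using that by (simp add: outer_square_def)
    \<comment> \<open>For \<open>d i < 0\<close> the diagonal entry is \<open>- d i\<close>, and the
      correction through \<open>i0\<close> adds \<open>2 * d i\<close>.\<close>
    have lamC: "lam ?C i = d i" if "i < k" for i
    proof (cases "d i < 0")
      case True
      then have "lam ?C i = (- d i) - 2 * ((sqrt (d i0) * sqrt (- d i)) * (sqrt (- d i) / sqrt (d i0)))"
        using that i0 by (simp add: lam_def C c_def real_sqrt_divide real_sqrt_minus)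
      moreover have "(sqrt (d i0) * sqrt (- d i)) * (sqrt (- d i) / sqrt (d i0)) = - d i"
        using i0(2) True by simp
      ultimately show ?thesis
        by simp
    qed (use that in \<open>simp add: lam_def C c_def\<close>)
    have "f ?C = v" by (simp add: f_def v lamC)
    moreover have "?C \<in> L"
      using outer_square_psd[of k c] i0 d1
      by (auto simp: L_def psd_cone_iff lamC C c_def)
    ultimately show ?thesis
      using outer_square_psd[of k c] by (intro rev_image_eqI[of ?C]) auto
  qed
  have conv: "convex (f ` (psd_cone k \<inter> L))"
    unfolding convex_def
  proof (intro ballI allI impI)
    fix x y and s t :: real
    assume "x \<in> f ` (psd_cone k \<inter> L)" "y \<in> f ` (psd_cone k \<inter> L)"
      and st: "0 \<le> s" "0 \<le> t" "s + t = 1"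
    then obtain A B where AB: "x = f A" "y = f B" "A \<in> psd_cone k" "A \<in> L" "B \<in> psd_cone k" "B \<in> L"
      by auto
    then have "s *\<^sub>R x + t *\<^sub>R y = f (s \<cdot>\<^sub>m A + t \<cdot>\<^sub>m B)"
      by (simp add: f_comb psd_cone_iff)
    moreover have "s \<cdot>\<^sub>m A + t \<cdot>\<^sub>m B \<in> psd_cone k \<inter> L"
      using AB st aff by (auto simp: affine_sym_subspace_def intro!: psd_cone_comb)
    ultimately show "s *\<^sub>R x + t *\<^sub>R y \<in> f ` (psd_cone k \<inter> L)" by blast
  qed
  have sub1: "H \<subseteq> f ` (psd_cone k \<inter> L)"
    unfolding H_def using conv p_in v_in by (intro hull_minimal) auto
  have sub2: "f X \<in> H" if X: "X \<in> psd_cone k" "X \<in> L" for X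
  proof -
    have symX: "X \<in> sym_mats k" using X by (simp add: psd_cone_iff)
    have nonneg: "lam X i \<ge> 0" if "i < k" "d i \<ge> 0" for i
    proof -
      have "0 \<le> 1\<^sup>2 * X $$ (i, i) + 2 * 1 * 0 * X $$ (i, i) + 0\<^sup>2 * X $$ (i, i)"
        unfolding mat_form_two_points[OF symX that(1,1), symmetric] using X(1) psd_cone_iff by blast
      then show ?thesis
        using that by (simp add: lam_def)
    qed
    have cross: "0 \<le> lam X i / d i - lam X j / d j"
      if ij: "i < k" "j < k" "d i > 0" "d j < 0" for i j
    proof -
      let ?s = "1 / sqrt (d i)" and ?t = "1 / sqrt (- d j)"
      have "0 \<le> ?s\<^sup>2 * X $$ (i, i) + 2 * ?s * ?t * X $$ (i, j) + ?t\<^sup>2 * X $$ (j, j)"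
        unfolding mat_form_two_points[OF symX ij(1,2), symmetric] using X(1) psd_cone_iff by blast
      moreover have "?s\<^sup>2 = 1 / d i" "?t\<^sup>2 = - 1 / d j"
        using ij by (auto simp: power_divide)
      moreover have "lam X i / d i - lam X j / d j =
          X $$ (i, i) / d i - X $$ (j, j) / d j + 2 * ?s * ?t * X $$ (i, j)"
      proof -
        \<comment> \<open>\<open>lam X j\<close> uses the entry at \<open>(i0, j)\<close>;
          membership in \<open>L\<close> exchanges it for the one at \<open>(i, j)\<close> that
          occurs in the form.\<close>
        have Xij: "X $$ (i, j) * sqrt (d i0) = X $$ (i0, j) * sqrt (d i)"
          using X(2) ij by (simp add: L_def)
        have "2 * X $$ (i0, j) * sqrt (- d j / d i0) / d j = - (2 * ?s * ?t * X $$ (i, j))"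
        proof -
          define a b c where "a = sqrt (d i)" and "b = sqrt (d i0)" and "c = sqrt (- d j)"
          have abc: "a > 0" "b > 0" "c > 0" using ij i0 by (auto simp: a_def b_def c_def)
          have dj: "d j = - (c * c)" using ij by (simp add: c_def)
          have sq: "sqrt (- d j / d i0) = c / b"
            unfolding b_def c_def by (rule real_sqrt_divide)
          have x: "X $$ (i0, j) = X $$ (i, j) * b / a"
            using Xij abc by (simp add: a_def b_def field_simps)
          have "2 * X $$ (i0, j) * (c / b) / - (c * c) = - (2 * (1 / a) * (1 / c) * X $$ (i, j))"
            using abc by (simp add: x field_simps)
          then show ?thesis
            unfolding sq a_def[symmetric] c_def[symmetric] by (simp add: dj)
        qed
        then show ?thesis
          using ij by (simp add: lam_def add_divide_distrib)
      qed
      ultimately show ?thesis by simp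
    qed
    define I where "I = {i. i < k \<and> d i > 0}"
    have I: "finite I" "i0 \<in> I" using i0 by (auto simp: I_def)
    \<comment> \<open>\<open>t\<close> is the largest weight that can be moved onto \<open>v\<close>.\<close>
    define t where "t = Min ((\<lambda>i. lam X i / d i) ` I)"
    have t_le: "t \<le> lam X i / d i" if "i \<in> I" for i
      using that I by (auto simp: t_def)
    have "t \<in> (\<lambda>i. lam X i / d i) ` I"
      unfolding t_def using I by (intro Min_in) auto
    then obtain m where m: "m \<in> I" "t = lam X m / d m" by auto
    have t0: "t \<ge> 0" using m nonneg[of m] by (auto simp: I_def)
    define mu where "mu i = lam X i - t * d i" for i
    have mu0: "mu i \<ge> 0" if "i < k" for i
    proof -
      consider "d i > 0" | "d i = 0" | "d i < 0" by linarith
      then show ?thesis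
      proof cases
        case 1
        then show ?thesis using t_le[of i] that by (simp add: mu_def I_def field_simps)
      next
        case 2
        then show ?thesis using nonneg[of i] that by (simp add: mu_def)
      next
        case 3
        \<comment> \<open>The slack of \<open>i\<close> against the minimising index
          \<open>m\<close>; multiplying by the negative \<open>d i\<close> reverses the
          inequality.\<close>
        then have "lam X i / d i \<le> t" using cross[of m i] m that by (simp add: I_def)
        then show ?thesis using 3 by (simp add: mu_def field_simps)
      qed
    qed
    have sum1: "(\<Sum>i<k. mu i) + t = 1"
    proof -
      have "(\<Sum>i<k. mu i) = (\<Sum>i<k. lam X i) - t * (\<Sum>i<k. d i)"
        by (simp add: mu_def sum_subtractf sum_distrib_left)
      then show ?thesis using X(2) d1 by (simp add: L_def)
    qed
    have fX: "f X = (\<Sum>i<k. mu i *\<^sub>R p i) + t *\<^sub>R v"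
      by (simp add: f_def v mu_def scaleR_right.sum scaleR_diff_left sum_subtractf)
    \<comment> \<open>Index \<open>k\<close> stands for \<open>v\<close>, so that all
      \<open>k + 1\<close> points form one family even when some coincide.\<close>
    define w where "w i = (if i < k then mu i else t)" for i
    define r where "r i = (if i < k then p i else v)" for i
    have "(\<Sum>i<Suc k. w i *\<^sub>R r i) \<in> H"
    proof (rule convex_sum)
      show "convex H" by (simp add: H_def)
      show "(\<Sum>i<Suc k. w i) = 1" using sum1 by (simp add: w_def)
      show "r i \<in> H" if "i \<in> {..<Suc k}" for i
        by (auto simp: r_def H_def intro: hull_inc)
    qed (use mu0 t0 in \<open>auto simp: w_def\<close>)
    then show ?thesis by (simp add: fX w_def r_def)
  qed
  have "H = f ` (psd_cone k \<inter> L)"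
    using sub1 sub2 by auto
  then show ?thesis
    unfolding has_psd_lift_def H_def using aff lin by blast
qed

text \<open>The coefficients of a nontrivial affine dependence sum to \<open>0\<close>, so some
  \<open>u v\<close> is negative. Solving for \<open>v\<close> gives coefficients \<open>e\<close>
  with sum \<open>1\<close>, of which a positive one supplies \<open>i0\<close>.\<close>

lemma psd_lift_affine_dependent:
  fixes V :: "'a::real_vector set"
  assumes "finite V" "affine_dependent V" "card V = Suc k"
  shows "has_psd_lift k (convex hull V)"
proof -
  obtain u where u: "sum u V = 0" "\<exists>w\<in>V. u w \<noteq> 0" "(\<Sum>w\<in>V. u w *\<^sub>R w) = 0"
    using assms(1,2) by (auto simp: affine_dependent_explicit_finite)
  have ex_neg: "\<exists>w\<in>V. u w < 0"
  proof (rule ccontr)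
    assume "\<not> ?thesis"
    then have "\<And>w. w \<in> V \<Longrightarrow> 0 \<le> u w"
      by (simp add: not_less)
    then have "\<forall>w\<in>V. u w = 0"
      using u(1) sum_nonneg_eq_0_iff[OF assms(1), of u] by simp
    then show False using u(2) by simp
  qed
  then obtain v where v: "v \<in> V" "u v < 0" by auto
  define W where "W = V - {v}"
  have W: "finite W" "card W = k" "V = insert v W" "v \<notin> W"
    using assms v by (auto simp: W_def)
  define e where "e w = u w / (- u v)" for w
  have eW: "sum e W = 1"
  proof -
    have "u v + sum u W = 0" using u(1) W by simp
    then have "sum u W = - u v" by simp
    then show ?thesis
      using v(2) by (simp add: e_def sum_divide_distrib[symmetric] sum_negf)
  qed
  have vW: "v = (\<Sum>w\<in>W. e w *\<^sub>R w)"
  proof -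
    have "u v *\<^sub>R v + (\<Sum>w\<in>W. u w *\<^sub>R w) = 0" using u(3) W by simp
    then have "(\<Sum>w\<in>W. u w *\<^sub>R w) = (- u v) *\<^sub>R v" 
      by (simp add: eq_neg_iff_add_eq_0 add.commute)
    then have "(1 / (- u v)) *\<^sub>R (\<Sum>w\<in>W. u w *\<^sub>R w) = v" using v(2) by simp
    moreover have "(1 / (- u v)) *\<^sub>R (\<Sum>w\<in>W. u w *\<^sub>R w) = (\<Sum>w\<in>W. e w *\<^sub>R w)"
      unfolding scaleR_right.sum by (simp add: e_def)
    ultimately show ?thesis by simp
  qed
  obtain p where p: "bij_betw p {..<k} W"
    using ex_bij_betw_nat_finite[OF W(1)] W(2) by (auto simp: atLeast0LessThan)
  have "\<exists>w\<in>W. e w > 0"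
  proof (rule ccontr)
    assume "\<not> ?thesis"
    then have "sum e W \<le> 0" by (intro sum_nonpos) force
    then show False using eW by simp
  qed
  then obtain i0 where i0: "i0 < k" "e (p i0) > 0"
    using p by (auto simp: bij_betw_def)
  have "(\<Sum>i<k. e (p i)) = 1" "v = (\<Sum>i<k. e (p i) *\<^sub>R p i)"
    using eW vW sum.reindex_bij_betw[OF p, of e] sum.reindex_bij_betw[OF p, of "\<lambda>w. e w *\<^sub>R w"]
    by simp_all
  then have "has_psd_lift k (convex hull (insert v (p ` {..<k})))"
    using i0 by (intro psd_lift_points_with_dependency)
  then show ?thesis
    using p W(3) by (simp add: bij_betw_def)
qed

theorem theorem4p3:
  fixes P :: "(real ^ 'n) set"
  assumes "polytope P"
    and "aff_dim P = int CARD('n)"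
    and "card {x. x extreme_point_of P} = CARD('n) + 2"
  shows "psd_rank P = CARD('n) + 1"
  unfolding psd_rank_def
proof (rule Least_equality)
  let ?V = "{x. x extreme_point_of P}"
  \<comment> \<open>Infinite sets have \<open>card\<close> equal to \<open>0\<close>, so the
    positive vertex count forces finiteness.\<close>
  have fin: "finite ?V"
    using assms(3) card_ge_0_finite[of ?V] by simp
  have "affine_dependent ?V"
    using fin assms(3) by (intro affine_dependent_biggerset) simp_all
  then have "has_psd_lift (CARD('n) + 1) (convex hull ?V)"
    using fin assms(3) by (intro psd_lift_affine_dependent) simp_all
  moreover have "P = convex hull ?V"
    using assms(1) by (intro Krein_Milman_Minkowski polytope_imp_compact polytope_imp_convex)
  ultimately show "CARD('n) + 1 > 0 \<and> has_psd_lift (CARD('n) + 1) P"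
    by simp
  show "CARD('n) + 1 \<le> k" if "k > 0 \<and> has_psd_lift k P" for k
    using that assms(1,2) by (intro psd_lift_size_ge[of k P]) (auto simp: Suc_le_eq)
qed

end
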